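(* Let $k$ and $\ell$ be coprime positive integers with $k$ odd, and write $q:=2^k$ and $Q:=2^\ell$. Write $R(X,Y):=(X+\alpha Y)^{Q+1}+(\beta Y)^{Q+1}$ with $\alpha,\beta\in\mathbb{F}_q^*$. Then the function $\psi\colon(x,y)\mapsto\bigl(R(x,y),R(y,x)\bigr)$ permutes $\mathbb{F}_q\times\mathbb{F}_q$ if and only if $\beta\ne\alpha+1$ and $u^Q=e^{Q-1}v$, where $$e:=(\alpha+1)^{2Q+2}+\beta^{2Q+2},$$ $$u:=(\alpha+1)^{2Q+2}+\alpha^{2Q+1}+\alpha+\alpha^Q\beta^{Q+1}+\beta^{2Q+2},$$ $$v:=(\alpha+1)^{2Q+2}+\alpha^{Q+2}+\alpha^Q+\alpha\beta^{Q+1}+\beta^{2Q+2}.$$ *)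

theory Defs
  imports "HOL-Library.Cardinality"
begin

text \<open>
  The field \<open>F_q\<close> is a finite field type \<open>'a\<close> with \<open>CARD('a) = q\<close>. Only the values of
  \<open>R\<close> on \<open>F_q \<times> F_q\<close> enter the statement, so \<open>R\<close> is given as a function; its degree
  parameter \<open>Q\<close> is an arbitrary natural number here.
\<close>

definition R_fun :: "nat \<Rightarrow> 'a::field \<Rightarrow> 'a \<Rightarrow> 'a \<Rightarrow> 'a \<Rightarrow> 'a" where
  "R_fun Q \<alpha> \<beta> x y = (x + \<alpha> * y) ^ (Q + 1) + (\<beta> * y) ^ (Q + 1)"

definition psi :: "nat \<Rightarrow> 'a::field \<Rightarrow> 'a \<Rightarrow> 'a \<times> 'a \<Rightarrow> 'a \<times> 'a" where
  "psi Q \<alpha> \<beta> = (\<lambda>(x, y). (R_fun Q \<alpha> \<beta> x y, R_fun Q \<alpha> \<beta> y x))"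

definition e_coef :: "nat \<Rightarrow> 'a::field \<Rightarrow> 'a \<Rightarrow> 'a" where
  "e_coef Q \<alpha> \<beta> = (\<alpha> + 1) ^ (2 * Q + 2) + \<beta> ^ (2 * Q + 2)"

definition u_coef :: "nat \<Rightarrow> 'a::field \<Rightarrow> 'a \<Rightarrow> 'a" where
  "u_coef Q \<alpha> \<beta> =
     (\<alpha> + 1) ^ (2 * Q + 2) + \<alpha> ^ (2 * Q + 1) + \<alpha> + \<alpha> ^ Q * \<beta> ^ (Q + 1) + \<beta> ^ (2 * Q + 2)"

definition v_coef :: "nat \<Rightarrow> 'a::field \<Rightarrow> 'a \<Rightarrow> 'a" where
  "v_coef Q \<alpha> \<beta> =
     (\<alpha> + 1) ^ (2 * Q + 2) + \<alpha> ^ (Q + 2) + \<alpha> ^ Q + \<alpha> * \<beta> ^ (Q + 1) + \<beta> ^ (2 * Q + 2)"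

end

(*
  Let beta /= alpha + 1; otherwise psi(1,1) = 0. In the coordinates s = x + y and z = y / s the map
  psi becomes, up to an invertible linear change
  of the output, the homogenization of the rational function
    f(z) = (z^(Q+1) + rho z + A) / (z^Q + z + rho + 1),
  and since Q + 1 is prime to q - 1, psi is injective iff f permutes the projective line. The
  coefficient identity of the theorem says A^Q + A = rho^2 + rho.

  If that identity holds, f(z) = f(z + 1/r) forces g^Q + g = rho + 1 for g = r (z^2 + z + A) + z.
  The image of x^Q + x has index 2 and misses 1, so this is impossible as soon as rho lies in the
  image; that it does follows from the fact that R, a sum of two (Q+1)-st powers of linear forms,
  has just one zero on the projective line.

  Conversely let f permute F_q and let z0^2 + z0 = A. Then f + z0 is the product of z + z0 and
  z^Q + z0 + rho, divided by the denominator of f. If z0 lies in F_q, the two zeros of f + z0 must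
  agree, which is the identity. Otherwise T(z) = (z + z0) / (z + z0 + 1) maps the projective line
  onto the (q+1)-st roots of unity and conjugates f to a function whose sum over these roots is a
  power of s / (s + 1), where s = z0^P + z0 + rho and x^P = x^Q on F_q. A permutation has sum 0, so
  s is 0 or 1, which is again the identity.
*)

theory Submission
  imports Defs "HOL-Algebra.Algebraic_Closure_Type"
begin

subsection \<open>Finite fields of characteristic two\<close>

lemma finite_field_power_card:
  fixes x :: "'a::{field,finite}"
  shows "x ^ CARD('a) = x"
proof (cases "x = 0")
  case True
  then show ?thesis by simp
next
  case False
  let ?S = "UNIV - {0::'a}"
  have bij: "bij_betw ((*) x) ?S ?S"
    by (rule bij_betwI[where g = "\<lambda>y. y / x"]) (use False in auto)
  have "prod id ?S = (\<Prod>y\<in>?S. x * y)"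
    using prod.reindex_bij_betw[OF bij, of id] by simp
  also have "\<dots> = x ^ card ?S * prod id ?S"
    by (simp add: prod.distrib)
  finally have "x ^ card ?S = 1"
    by simp
  moreover have "CARD('a) = Suc (card ?S)"
    by (simp add: card_Suc_Diff1)
  ultimately show ?thesis
    by (simp only: power_Suc mult_1_right)
qed

lemma two_eq_zero_of_card:
  assumes "CARD('a::{field,finite}) = 2 ^ k" and "k > 0"
  shows "(2::'a) = 0"
proof -
  have "even (2 ^ k :: nat)"
    using assms(2) by simp
  then have "(-1::'a) = 1"
    using finite_field_power_card[of "-1::'a"] assms(1) by simp
  then show ?thesis
    by (metis add.right_inverse one_add_one)
qed

lemma add_self_char2:
  fixes x :: "'a::comm_ring_1"
  assumes "(2::'a) = 0"
  shows "x + x = 0"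
  using assms by (metis mult_2 mult_zero_left)

lemma add_eq_zero_char2:
  fixes x y :: "'a::comm_ring_1"
  assumes "(2::'a) = 0"
  shows "x + y = 0 \<longleftrightarrow> x = y"
  using add_self_char2[OF assms] by (metis add_right_imp_eq)

lemma add_left_self_char2:
  fixes x y :: "'a::comm_ring_1"
  assumes "(2::'a) = 0"
  shows "x + (x + y) = y"
  using add_self_char2[OF assms, of x] by (simp add: add.assoc[symmetric])

lemmas char2_cancel = add_self_char2 add_left_self_char2
lemmas expand = distrib_left distrib_right add_ac mult_ac power2_eq_square

lemma add_power_two_power:
  fixes x y :: "'a::comm_ring_1"
  assumes "(2::'a) = 0"
  shows "(x + y) ^ 2 ^ n = x ^ 2 ^ n + y ^ 2 ^ n"
proof (induction n)
  case (Suc n)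
  have "(x + y) ^ 2 ^ Suc n = ((x + y) ^ 2 ^ n)\<^sup>2"
    by (simp add: power_mult[symmetric] mult.commute)
  also have "\<dots> = (x ^ 2 ^ n + y ^ 2 ^ n)\<^sup>2"
    by (simp only: Suc)
  also have "\<dots> = (x ^ 2 ^ n)\<^sup>2 + (y ^ 2 ^ n)\<^sup>2"
    using assms by (simp add: power2_sum)
  finally show ?case
    by (simp add: power_mult[symmetric] mult.commute)
qed simp

lemma square_eq_self_cases:
  fixes x :: "'a::field"
  assumes "x\<^sup>2 = x"
  shows "x = 0 \<or> x = 1"
  using assms by (simp add: power2_eq_square)

lemma square_add_self_eq_iff:
  fixes x y :: "'a::field"
  assumes "(2::'a) = 0"
  shows "x\<^sup>2 + x = y\<^sup>2 + y \<longleftrightarrow> x = y \<or> x = y + 1"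
proof
  assume "x\<^sup>2 + x = y\<^sup>2 + y"
  moreover have "(x + y) * (x + y + 1) = (x\<^sup>2 + x) + (y\<^sup>2 + y)"
    by (simp add: char2_cancel[OF assms] expand)
  ultimately have "(x + y) * (x + y + 1) = 0"
    using add_self_char2[OF assms] by metis
  then show "x = y \<or> x = y + 1"
    using add_eq_zero_char2[OF assms, of x y] add_eq_zero_char2[OF assms, of x "y + 1"]
    by (auto simp: add.assoc)
next
  assume "x = y \<or> x = y + 1"
  then show "x\<^sup>2 + x = y\<^sup>2 + y"
    by (auto simp: char2_cancel[OF assms] expand)
qed

lemma iterate_power_fixed:
  fixes x :: "'a::monoid_mult"
  assumes "x ^ n = x"
  shows "x ^ n ^ m = x"
  by (induction m) (simp_all add: power_mult assms)

text \<open>F_(2^n) and F_(2^k) meet in F_2: with \<open>n * a = k * b + 1\<close>, iterating x ->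
  x^(2^n) \<open>a\<close> times amounts to iterating x -> x^q \<open>b\<close> times, which is the
  identity, followed by one squaring.\<close>

lemma coprime_frobenius_fixed:
  fixes x :: "'a::{field,finite}"
  assumes "CARD('a) = 2 ^ k" and "k > 0" and "n > 0" and "coprime n k" and "x ^ 2 ^ n = x"
  shows "x = 0 \<or> x = 1"
proof -
  obtain a b where ab: "n * a = k * b + 1"
    using bezout_nat[of n k] assms by (metis coprime_iff_gcd_eq_1 neq0_conv)
  have "x = x ^ (2 ^ n) ^ a"
    using iterate_power_fixed[OF assms(5)] by simp
  also have "\<dots> = x ^ ((2 ^ k) ^ b * 2)"
    using ab by (simp add: power_mult[symmetric] mult.commute)
  also have "\<dots> = x\<^sup>2"
    using iterate_power_fixed[OF finite_field_power_card[of x], of b] assms(1)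
    by (simp only: power_mult)
  finally show ?thesis
    by (intro square_eq_self_cases) simp
qed

section \<open>The maps x^Q, x^Q + x and x^(Q + 1) on F_q\<close>

locale gold_field =
  fixes k l Q :: nat and ty :: "'a::{field,finite} itself"
  assumes k: "k > 0" "odd k" and l: "l > 0" and cop: "coprime k l"
    and Q: "Q = 2 ^ l" and card: "CARD('a) = 2 ^ k"
begin

lemma two: "(2::'a) = 0"
  by (rule two_eq_zero_of_card[OF card k(1)])

lemma two_mult [simp]: "2 * x = (0::'a)"
  by (simp add: two)

lemma add_self [simp]: "x + x = (0::'a)"
  by (rule add_self_char2[OF two])

lemma add_left_self [simp]: "x + (x + y) = (y::'a)"
  by (rule add_left_self_char2[OF two])

lemma add_eq_0: "x + y = (0::'a) \<longleftrightarrow> x = y"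
  by (rule add_eq_zero_char2[OF two])

lemma power_Q_add: "(x + y) ^ Q = x ^ Q + (y::'a) ^ Q"
  unfolding Q by (rule add_power_two_power[OF two])

lemma Q_pos: "Q > 0"
  by (simp add: Q)

text \<open>Oddness of \<open>k\<close> enters here: it makes \<open>2 * l\<close> coprime to
  \<open>k\<close>.\<close>

lemma fixed_power_Q_twice: "(x ^ Q) ^ Q = x \<Longrightarrow> x = 0 \<or> x = (1::'a)"
proof -
  assume *: "(x ^ Q) ^ Q = x"
  have "coprime (2 * l) k"
    using cop k(2) by (simp add: coprime_commute[of l])
  moreover have "x ^ 2 ^ (2 * l) = x"
    using * unfolding Q mult_2 power_add power_mult .
  ultimately show ?thesis
    using coprime_frobenius_fixed[OF card k(1), of "2 * l" x] l by simp
qed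

lemma power_Q_eq_self_iff: "x ^ Q = x \<longleftrightarrow> x = 0 \<or> x = (1::'a)"
  using fixed_power_Q_twice[of x] Q_pos by auto

text \<open>If x^Q = x + 1, then the twofold Q-th power fixes x, so x lies in F_2, where x^Q =
  x.\<close>

lemma power_Q_add_self_ne_one: "x ^ Q + x \<noteq> (1::'a)"
proof
  assume "x ^ Q + x = 1"
  then have *: "x ^ Q = x + 1"
    by (metis add_left_self add.commute)
  then have "(x ^ Q) ^ Q = x"
    by (simp add: power_Q_add add.assoc)
  then show False
    using fixed_power_Q_twice[of x] * power_Q_eq_self_iff[of x] by auto
qed

text \<open>The quotient t of two solutions has t^Q = 1/t, so the twofold Q-th power fixes it; being
  nonzero, it is 1.\<close>

lemma power_Suc_Q_eq_iff: "x ^ (Q + 1) = y ^ (Q + 1) \<longleftrightarrow> x = (y::'a)"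
proof (cases "y = 0")
  case False
  show ?thesis
  proof
    assume *: "x ^ (Q + 1) = y ^ (Q + 1)"
    define t where "t = x / y"
    have "t ^ (Q + 1) = 1"
      using * False unfolding t_def power_divide by simp
    then have t: "t ^ Q = inverse t" "t \<noteq> 0"
      by (auto simp: inverse_unique mult.commute)
    then have "(t ^ Q) ^ Q = t"
      by (simp add: power_inverse)
    then have "t = 1"
      using fixed_power_Q_twice[of t] t(2) by blast
    then show "x = y"
      using False by (simp add: t_def)
  qed simp
qed auto

lemma power_Suc_Q_surj: "\<exists>x. x ^ (Q + 1) = (y::'a)"
proof -
  have "inj (\<lambda>x::'a. x ^ (Q + 1))"
    by (rule injI) (simp only: power_Suc_Q_eq_iff)
  then have "surj (\<lambda>x::'a. x ^ (Q + 1))"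
    by (simp add: finite_UNIV_inj_surj)
  then show ?thesis
    by (metis surjD)
qed

lemma power_Q_eq_iff: "x ^ Q = y ^ Q \<longleftrightarrow> x = (y::'a)"
proof
  assume "x ^ Q = y ^ Q"
  then have "(x + y) ^ Q = 0" by (simp add: power_Q_add)
  then show "x = y" by (simp add: add_eq_0)
qed simp

lemma power_Q_surj: "\<exists>x. x ^ Q = (y::'a)"
proof -
  have "inj (\<lambda>x::'a. x ^ Q)"
    by (rule injI) (simp only: power_Q_eq_iff)
  then have "surj (\<lambda>x::'a. x ^ Q)"
    by (simp add: finite_UNIV_inj_surj)
  then show ?thesis
    by (metis surjD)
qed

text \<open>The additive map x^Q + x has kernel F_2, so its image has index 2; as 1 lies outside,
  the two cosets are the image and its translate by 1.\<close>

lemma artin_schreier_dichotomy: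
  fixes y :: 'a
  shows "(\<exists>x. x ^ Q + x = y) \<or> (\<exists>x. x ^ Q + x = y + 1)"
proof -
  define f where "f = (\<lambda>x::'a. x ^ Q + x)"
  have f_add: "f (x + z) = f x + f z" for x z
    by (simp add: f_def power_Q_add)
  have f0: "f x = 0 \<longleftrightarrow> x = 0 \<or> x = 1" for x
    by (simp add: f_def add_eq_0 power_Q_eq_self_iff)
  have fib: "{x. f x = f z} = {z, z + 1}" for z
  proof -
    have "f x = f z \<longleftrightarrow> f (x + z) = 0" for x
      by (simp add: f_add add_eq_0)
    then have "f x = f z \<longleftrightarrow> x = z \<or> x = z + 1" for x
      using add_eq_0[of x z] add_eq_0[of x "z + 1"] f0[of "x + z"] add_eq_0[of "x + z" 1]
      by (simp add: add.assoc)
    then show ?thesis by auto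
  qed
  have "CARD('a) = (\<Sum>x\<in>(UNIV::'a set). 1)"
    by simp
  also have "\<dots> = (\<Sum>y\<in>range f. \<Sum>x\<in>{x. x \<in> UNIV \<and> f x = y}. 1)"
    by (rule sum.image_gen) simp
  also have "\<dots> = (\<Sum>y\<in>range f. 2)"
  proof (rule sum.cong)
    fix y assume "y \<in> range f"
    then obtain z where "y = f z" by auto
    then show "(\<Sum>x\<in>{x. x \<in> UNIV \<and> f x = y}. 1) = (2::nat)"
      using fib[of z] by simp
  qed simp
  finally have half: "CARD('a) = 2 * card (range f)"
    by simp
  let ?G = "(\<lambda>y. y + 1) ` range f"
  have "range f \<inter> ?G = {}"
  proof (rule ccontr)
    assume "range f \<inter> ?G \<noteq> {}"
    then obtain x z where "f x = f z + 1" by auto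
    then have "f (x + z) = 1"
      by (simp add: f_add expand)
    then show False
      using power_Q_add_self_ne_one by (simp add: f_def)
  qed
  then have "card (range f \<union> ?G) = CARD('a)"
    using half by (simp add: card_Un_disjoint card_image)
  then have "range f \<union> ?G = UNIV"
    by (simp add: card_eq_UNIV_imp_eq_UNIV)
  then consider x where "y = f x" | x where "y = f x + 1"
    by (metis (no_types, lifting) UNIV_I UnE imageE)
  then show ?thesis
  proof cases
    case 2
    then have "f x = y + 1" by (simp add: add.assoc)
    then show ?thesis unfolding f_def by blast
  qed (auto simp: f_def)
qed

end

subsection \<open>The associated rational function\<close>

definition num :: "nat \<Rightarrow> 'a::field \<Rightarrow> 'a \<Rightarrow> 'a \<Rightarrow> 'a" where
  "num Q \<rho> A z = z ^ (Q + 1) + \<rho> * z + A"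

definition den :: "nat \<Rightarrow> 'a::field \<Rightarrow> 'a \<Rightarrow> 'a" where
  "den Q \<rho> z = z ^ Q + z + \<rho> + 1"

text \<open>Homogenizations of \<open>num\<close> and \<open>den\<close> in degree Q + 1, with z = y
  / s. For Q > 0, \<open>form2\<close> vanishes on s = 0, the point at infinity, which the fraction
  therefore fixes.\<close>

definition form1 :: "nat \<Rightarrow> 'a::field \<Rightarrow> 'a \<Rightarrow> 'a \<Rightarrow> 'a \<Rightarrow> 'a" where
  "form1 Q \<rho> A y s = y ^ (Q + 1) + \<rho> * y * s ^ Q + A * s ^ (Q + 1)"

definition form2 :: "nat \<Rightarrow> 'a::field \<Rightarrow> 'a \<Rightarrow> 'a \<Rightarrow> 'a" where
  "form2 Q \<rho> y s = y ^ Q * s + y * s ^ Q + (\<rho> + 1) * s ^ (Q + 1)"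

lemma form1_eq: "s \<noteq> 0 \<Longrightarrow> form1 Q \<rho> A y s = s ^ (Q + 1) * num Q \<rho> A (y / s)"
  by (simp add: form1_def num_def power_divide field_simps)

lemma form2_eq: "s \<noteq> 0 \<Longrightarrow> form2 Q \<rho> y s = s ^ (Q + 1) * den Q \<rho> (y / s)"
  by (simp add: form2_def den_def power_divide field_simps)

context gold_field
begin

text \<open>This is the numerator of f(z + 1/r) + f(z) for f = num / den. The substitution
  \<open>g\<close> turns a collision of f into g^Q + g = rho + 1, up to a multiple of the defect A^Q
  + A + rho^2 + rho of the coefficient identity.\<close>

lemma num_den_shift:
  fixes r z \<rho> A :: 'a
  assumes r: "r \<noteq> 0"
  defines "g \<equiv> r * (z\<^sup>2 + z + A) + z"
  shows "num Q \<rho> A (z + 1 / r) * den Q \<rho> z + num Q \<rho> A z * den Q \<rho> (z + 1 / r)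
    = (1 / r) ^ (Q + 1) * (g ^ Q + g + \<rho> + 1 + r ^ Q * (A ^ Q + A + \<rho>\<^sup>2 + \<rho>))"
proof -
  define t zq tq rq Aq where "t = 1 / r" and "zq = z ^ Q" and "tq = t ^ Q" and "rq = r ^ Q"
    and "Aq = A ^ Q"
  note defs = this
  have tr: "t * r = 1" and tqrq: "tq * rq = 1"
    using r by (auto simp: defs power_mult_distrib[symmetric])
  have shift: "(z + t) ^ Q = zq + tq"
    by (simp add: defs power_Q_add)
  have gq: "g ^ Q = rq * (zq\<^sup>2 + zq + Aq) + zq"
    unfolding g_def
    by (simp add: power_Q_add power_mult_distrib defs power_mult[symmetric] mult.commute)
  have "num Q \<rho> A (z + t) * den Q \<rho> z + num Q \<rho> A z * den Q \<rho> (z + t)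
    = ((zq + tq) * (z + t) + \<rho> * (z + t) + A) * (zq + z + \<rho> + 1)
      + (zq * z + \<rho> * z + A) * (zq + tq + (z + t) + \<rho> + 1)"
    by (simp add: num_def den_def shift zq_def[symmetric] mult.commute)
  also have "\<dots> = t * (zq\<^sup>2 + zq + A + \<rho>\<^sup>2 + \<rho>) + tq * (z\<^sup>2 + z + A) + t * tq * (zq + z + \<rho> + 1)"
    by (simp add: expand)
  \<comment> \<open>Trading A for Aq + (Aq + A) turns the first bracket into the Q-th power of z^2 +
    z + A plus the defect.\<close>
  also have "\<dots> = t * ((zq\<^sup>2 + zq + Aq) + (Aq + A + \<rho>\<^sup>2 + \<rho>)) + tq * (z\<^sup>2 + z + A)
      + t * tq * (zq + z + \<rho> + 1)"
    by (simp add: expand)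
  \<comment> \<open>Inserting \<open>tq * rq = 1\<close> and \<open>t * r = 1\<close> makes
    \<open>t * tq\<close> a common factor.\<close>
  also have "\<dots> = (tq * rq) * t * ((zq\<^sup>2 + zq + Aq) + (Aq + A + \<rho>\<^sup>2 + \<rho>))
      + (t * r) * tq * (z\<^sup>2 + z + A) + t * tq * (zq + z + \<rho> + 1)"
    by (simp add: tr tqrq)
  also have "\<dots> = t * tq * (rq * (zq\<^sup>2 + zq + Aq) + zq + (r * (z\<^sup>2 + z + A) + z) + \<rho> + 1
      + rq * (Aq + A + \<rho>\<^sup>2 + \<rho>))"
    by (simp add: expand)
  also have "\<dots> = t ^ (Q + 1) * (g ^ Q + g + \<rho> + 1 + r ^ Q * (A ^ Q + A + \<rho>\<^sup>2 + \<rho>))"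
    unfolding gq unfolding g_def defs by (simp only: power_add power_one_right mult.commute)
  finally show ?thesis
    by (simp only: t_def)
qed

lemma den_nonzero_iff: "(\<forall>z. den Q \<rho> z \<noteq> 0) \<longleftrightarrow> (\<nexists>x. x ^ Q + x = \<rho> + (1::'a))"
  by (auto simp: den_def add.assoc add_eq_0[of "_ + _", unfolded add.assoc])

lemma artin_schreier_disjoint:
  assumes "x ^ Q + x = y"
  shows "z ^ Q + z \<noteq> y + (1::'a)"
proof
  assume *: "z ^ Q + z = y + 1"
  have "(x + z) ^ Q + (x + z) = (x ^ Q + x) + (z ^ Q + z)"
    by (simp add: power_Q_add ac_simps)
  then have "(x + z) ^ Q + (x + z) = 1"
    using assms * by simp
  then show False
    using power_Q_add_self_ne_one by blast
qed

text \<open>Here rho + 1 is outside the image of x^Q + x, so \<open>den\<close> has no zero and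
  \<open>form2\<close> vanishes only at s = 0. Distinct ratios y / s cannot collide by
  \<open>num_den_shift\<close>; once the ratios agree, s is recovered from s^(Q + 1).\<close>

lemma forms_inj:
  fixes \<rho> A :: 'a
  assumes cond: "A ^ Q + A = \<rho>\<^sup>2 + \<rho>" and rho: "\<exists>x. x ^ Q + x = \<rho>"
    and eq1: "form1 Q \<rho> A y s = form1 Q \<rho> A y' s'"
    and eq2: "form2 Q \<rho> y s = form2 Q \<rho> y' s'"
  shows "y = y' \<and> s = s'"
proof -
  have no: "x ^ Q + x \<noteq> \<rho> + 1" for x
    using rho artin_schreier_disjoint by blast
  then have den: "den Q \<rho> z \<noteq> 0" for z
    using den_nonzero_iff by blast
  have form2_0: "form2 Q \<rho> y s = 0 \<longleftrightarrow> s = 0" for y s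
    using form2_eq[of s Q \<rho> y] den[of "y / s"] Q_pos by (cases "s = 0") (auto simp: form2_def)
  show ?thesis
  proof (cases "s = 0")
    case True
    then have "s' = 0"
      using eq2 form2_0 by metis
    then have "y ^ (Q + 1) = y' ^ (Q + 1)"
      using eq1 True Q_pos by (simp add: form1_def power_0_left)
    then show ?thesis
      using True \<open>s' = 0\<close> power_Suc_Q_eq_iff by blast
  next
    case False
    then have s': "s' \<noteq> 0"
      using eq2 form2_0 by metis
    define z z' where "z = y / s" and "z' = y' / s'"
    have e1: "s ^ (Q + 1) * num Q \<rho> A z = s' ^ (Q + 1) * num Q \<rho> A z'"
      and e2: "s ^ (Q + 1) * den Q \<rho> z = s' ^ (Q + 1) * den Q \<rho> z'"
      using eq1 eq2 False s' by (simp_all add: form1_eq form2_eq z_def z'_def)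
    have "(s ^ (Q + 1) * s' ^ (Q + 1)) * (num Q \<rho> A z' * den Q \<rho> z)
        = (s' ^ (Q + 1) * num Q \<rho> A z') * (s ^ (Q + 1) * den Q \<rho> z)"
      by (simp only: mult_ac)
    also have "\<dots> = (s ^ (Q + 1) * s' ^ (Q + 1)) * (num Q \<rho> A z * den Q \<rho> z')"
      unfolding e1[symmetric] e2 by (simp only: mult_ac)
    finally have cross: "num Q \<rho> A z' * den Q \<rho> z = num Q \<rho> A z * den Q \<rho> z'"
      using False s' by simp
    have "z = z'"
    proof (rule ccontr)
      assume "z \<noteq> z'"
      define r where "r = 1 / (z + z')"
      define g where "g = r * (z\<^sup>2 + z + A) + z"
      have r: "r \<noteq> 0" "z + 1 / r = z'"
        using \<open>z \<noteq> z'\<close> add_eq_0[of z z'] by (auto simp: r_def)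
      have "A ^ Q + A + \<rho>\<^sup>2 + \<rho> = 0"
        using cond by (simp add: add.assoc)
      then have "(1 / r) ^ (Q + 1) * (g ^ Q + g + \<rho> + 1) = 0"
        using num_den_shift[OF r(1), of \<rho> A z] cross r(2) by (simp add: g_def[symmetric])
      then have "g ^ Q + g + (\<rho> + 1) = 0"
        using r(1) by (simp add: add.assoc)
      then show False
        using no[of g] add_eq_0[of "g ^ Q + g" "\<rho> + 1"] by simp
    qed
    then have "s ^ (Q + 1) = s' ^ (Q + 1)"
      using e2 den[of z] by simp
    then have "s = s'"
      using power_Suc_Q_eq_iff by blast
    then show ?thesis
      using \<open>z = z'\<close> s' by (simp add: z_def z'_def)
  qed
qed

text \<open>Every element is a (Q + 1)-st power, so projective coincidences can be rescaled to equal
  form values: a zero of \<open>den\<close> would collide with a point at infinity, and equal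
  fractions collide after scaling by s.\<close>

lemma fraction_inj:
  fixes \<rho> A :: 'a
  assumes inj: "\<forall>y s y' s'. form1 Q \<rho> A y s = form1 Q \<rho> A y' s' \<longrightarrow>
    form2 Q \<rho> y s = form2 Q \<rho> y' s' \<longrightarrow> y = y' \<and> s = s'"
  shows "\<And>z. den Q \<rho> z \<noteq> 0" and "inj (\<lambda>z. num Q \<rho> A z / den Q \<rho> z)"
proof -
  have form_s1: "form1 Q \<rho> A z 1 = num Q \<rho> A z" "form2 Q \<rho> z 1 = den Q \<rho> z" for z
    by (simp_all add: form1_eq form2_eq)
  show den: "den Q \<rho> z \<noteq> 0" for z
  proof
    assume den0: "den Q \<rho> z = 0"
    obtain y where y: "y ^ (Q + 1) = num Q \<rho> A z"
      using power_Suc_Q_surj by blast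
    have "form1 Q \<rho> A y 0 = form1 Q \<rho> A z 1" "form2 Q \<rho> y 0 = form2 Q \<rho> z 1"
      using y den0 Q_pos form_s1 by (simp_all add: form1_def form2_def)
    from inj[rule_format, OF this] show False
      by simp
  qed
  show "inj (\<lambda>z. num Q \<rho> A z / den Q \<rho> z)"
  proof (rule injI)
    fix z z' assume eq: "num Q \<rho> A z / den Q \<rho> z = num Q \<rho> A z' / den Q \<rho> z'"
    obtain s where s: "s ^ (Q + 1) = den Q \<rho> z / den Q \<rho> z'"
      using power_Suc_Q_surj by blast
    have "s \<noteq> 0"
      using s den[of z] den[of z'] by auto
    have "form1 Q \<rho> A (s * z') s = s ^ (Q + 1) * num Q \<rho> A z'"
      "form2 Q \<rho> (s * z') s = s ^ (Q + 1) * den Q \<rho> z'"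
      using \<open>s \<noteq> 0\<close> by (simp_all add: form1_eq form2_eq)
    moreover have "num Q \<rho> A z = den Q \<rho> z / den Q \<rho> z' * num Q \<rho> A z'"
      using eq den[of z] den[of z'] by (simp add: field_simps)
    ultimately have "form1 Q \<rho> A (s * z') s = form1 Q \<rho> A z 1" "form2 Q \<rho> (s * z') s = form2 Q \<rho> z 1"
      unfolding s form_s1 using den[of z'] by simp_all
    from inj[rule_format, OF this] show "z = z'"
      by auto
  qed
qed

end

section \<open>Reduction of psi to the two forms\<close>

locale gold_pair = gold_field k l Q ty
  for k l Q :: nat and ty :: "'a::{field,finite} itself" +
  fixes \<alpha> \<beta> :: 'a
begin

text \<open>The forms \<open>R(y + s, y)\<close> and \<open>R(y, y + s)\<close> span the same pencil as \<open>form1\<close> and \<open>form2\<close> with the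
  parameters \<open>rho\<close> and \<open>AA\<close>; \<open>kappa\<^sup>2\<close> is the coefficient \<open>e\<close> of the theorem.\<close>

definition kappa :: 'a where "kappa = (\<alpha> + 1) ^ (Q + 1) + \<beta> ^ (Q + 1)"
definition rho :: 'a where "rho = (\<alpha> + \<alpha> ^ Q) / kappa"
definition cc :: 'a where "cc = (1 + \<alpha> ^ Q) / kappa"
definition AA :: 'a where
  "AA = (\<alpha> + \<alpha> ^ Q * (\<alpha> ^ (Q + 1) + \<beta> ^ (Q + 1))) / kappa\<^sup>2"

lemma kappa_eq: "kappa = 1 + \<alpha> + \<alpha> ^ Q + \<alpha> * \<alpha> ^ Q + \<beta> ^ (Q + 1)"
  by (simp add: kappa_def power_Q_add expand)

lemma kappa_eq_0: "kappa = 0 \<longleftrightarrow> \<beta> = \<alpha> + 1"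
  unfolding kappa_def add_eq_0 using power_Suc_Q_eq_iff[of "\<alpha> + 1" \<beta>] by blast

text \<open>This is the substitution x = y + s. The coefficient rows (1, cc) and (1, cc + 1) have
  determinant 1, so passing from psi to the two forms is an invertible linear change of the
  output.\<close>

lemma R_forms:
  assumes "kappa \<noteq> 0"
  shows "R_fun Q \<alpha> \<beta> (y + s) y = kappa * (form1 Q rho AA y s + cc * form2 Q rho y s)" (is ?th1)
    and "R_fun Q \<alpha> \<beta> y (y + s) = kappa * (form1 Q rho AA y s + (cc + 1) * form2 Q rho y s)" (is ?th2)
proof -
  define a b K yq sq where "a = \<alpha> ^ Q" and "b = \<beta> ^ (Q + 1)" and "K = kappa" and "yq = y ^ Q"
    and "sq = s ^ Q"
  note defs = this
  \<comment> \<open>Solving \<open>kappa_eq\<close> for b lets K replace b in the identities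
    below.\<close>
  have "b = (1 + \<alpha> + a + \<alpha> * a) + ((1 + \<alpha> + a + \<alpha> * a) + b)"
    by (simp only: add_left_self)
  then have b: "b = 1 + \<alpha> + a + \<alpha> * a + K"
    by (simp only: defs kappa_eq)
  have K: "K \<noteq> 0" using assms by (simp add: K_def)
  have rhoK: "K * rho = \<alpha> + a" and ccK: "K * cc = 1 + a"
    using K by (simp_all add: rho_def cc_def K_def a_def)
  have AAK: "K * (K * AA) = \<alpha> + a * (\<alpha> * a + b)"
    using K by (simp add: AA_def K_def a_def b_def power2_eq_square)
  \<comment> \<open>Multiplying by K twice clears the denominator of \<open>AA\<close>, so that only
    polynomial identities remain.\<close>
  have f1: "K * (K * form1 Q rho AA y s)
      = K * K * yq * y + K * (K * rho) * y * sq + (K * (K * AA)) * sq * s"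
    by (simp add: form1_def defs algebra_simps)
  have f2: "K * form2 Q rho y s = K * yq * s + K * y * sq + (K * rho + K) * sq * s"
    by (simp add: form2_def defs algebra_simps)
  have "K * (K * (form1 Q rho AA y s + cc * form2 Q rho y s))
      = K * (K * form1 Q rho AA y s) + (K * cc) * (K * form2 Q rho y s)"
    by (simp add: algebra_simps)
  also have "\<dots> = K * ((yq + sq + a * yq) * (y + s + \<alpha> * y) + b * yq * y)"
    by (simp add: f1 f2 rhoK ccK AAK b expand)
  also have "\<dots> = K * R_fun Q \<alpha> \<beta> (y + s) y"
    by (simp add: R_fun_def power_Q_add power_mult_distrib defs mult_ac)
  finally show ?th1
    using K by (simp add: K_def)
  have "K * (K * (form1 Q rho AA y s + (cc + 1) * form2 Q rho y s))
      = K * (K * form1 Q rho AA y s) + (K * cc + K) * (K * form2 Q rho y s)"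
    by (simp add: algebra_simps)
  also have "\<dots> = K * ((yq + a * (yq + sq)) * (y + \<alpha> * (y + s)) + b * (yq + sq) * (y + s))"
    by (simp add: f1 f2 rhoK ccK AAK b expand)
  also have "\<dots> = K * R_fun Q \<alpha> \<beta> y (y + s)"
    by (simp add: R_fun_def power_Q_add power_mult_distrib defs mult_ac)
  finally show ?th2
    using K by (simp add: K_def)
qed

lemma psi_eq_iff:
  assumes "kappa \<noteq> 0"
  shows "psi Q \<alpha> \<beta> (y + s, y) = psi Q \<alpha> \<beta> (y' + s', y') \<longleftrightarrow>
    form1 Q rho AA y s = form1 Q rho AA y' s' \<and> form2 Q rho y s = form2 Q rho y' s'"
    (is "?L \<longleftrightarrow> ?R")
proof
  assume ?L
  then have e: "form1 Q rho AA y s + cc * form2 Q rho y s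
        = form1 Q rho AA y' s' + cc * form2 Q rho y' s'"
    and e2: "form1 Q rho AA y s + (cc + 1) * form2 Q rho y s
        = form1 Q rho AA y' s' + (cc + 1) * form2 Q rho y' s'"
    using assms by (simp_all add: psi_def R_forms)
  from e2 have "(form1 Q rho AA y s + cc * form2 Q rho y s) + form2 Q rho y s
        = (form1 Q rho AA y' s' + cc * form2 Q rho y' s') + form2 Q rho y' s'"
    by (simp only: distrib_right mult_1_left add.assoc)
  then have "form2 Q rho y s = form2 Q rho y' s'"
    unfolding e by (rule add_left_imp_eq)
  then show ?R
    using e by simp
qed (use assms in \<open>simp add: psi_def R_forms\<close>)

lemma inj_psi_iff:
  assumes "kappa \<noteq> 0"
  shows "inj (psi Q \<alpha> \<beta>) \<longleftrightarrow>
    (\<forall>y s y' s'. form1 Q rho AA y s = form1 Q rho AA y' s' \<longrightarrow>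
      form2 Q rho y s = form2 Q rho y' s' \<longrightarrow> y = y' \<and> s = s')"
    (is "_ \<longleftrightarrow> ?R")
proof
  assume inj: "inj (psi Q \<alpha> \<beta>)"
  show ?R
  proof (intro allI impI)
    fix y s y' s'
    assume "form1 Q rho AA y s = form1 Q rho AA y' s'" "form2 Q rho y s = form2 Q rho y' s'"
    then have "psi Q \<alpha> \<beta> (y + s, y) = psi Q \<alpha> \<beta> (y' + s', y')"
      using psi_eq_iff[OF assms] by blast
    then show "y = y' \<and> s = s'"
      using injD[OF inj] by fastforce
  qed
next
  assume R: ?R
  show "inj (psi Q \<alpha> \<beta>)"
  proof (rule injI)
    fix p p' assume eq: "psi Q \<alpha> \<beta> p = psi Q \<alpha> \<beta> p'"
    obtain x y x' y' where p: "p = (x, y)" "p' = (x', y')"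
      by fastforce
    define s s' where "s = y + x" and "s' = y' + x'"
    have x: "x = y + s" "x' = y' + s'"
      by (simp_all add: s_def s'_def)
    have "y = y' \<and> s = s'"
      using R psi_eq_iff[OF assms, of y s y' s'] eq unfolding p x by blast
    then show "p = p'"
      by (simp add: p x)
  qed
qed

lemma R_root_iff: "R_fun Q \<alpha> \<beta> x y = 0 \<longleftrightarrow> x + \<alpha> * y = \<beta> * y"
  unfolding R_fun_def add_eq_0 by (rule power_Suc_Q_eq_iff)

lemma R_num_den:
  assumes "kappa \<noteq> 0"
  shows "R_fun Q \<alpha> \<beta> (z + 1) z = kappa * (num Q rho AA z + cc * den Q rho z)"
    and "R_fun Q \<alpha> \<beta> z (z + 1) = kappa * (num Q rho AA z + (cc + 1) * den Q rho z)"
  using R_forms[OF assms, of z 1] by (simp_all add: form1_eq form2_eq)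

text \<open>If rho is outside the image, rho + 1 is inside, and \<open>num_den_shift\<close> read
  backwards produces collisions of the fraction. One is built at the value cc, which is taken only
  where R(z + 1, z) = 0, that is, at a single z.\<close>

lemma rho_in_range:
  assumes kappa: "kappa \<noteq> 0" and cond: "AA ^ Q + AA = rho\<^sup>2 + rho"
  shows "\<exists>x. x ^ Q + x = rho"
proof (rule ccontr)
  assume none: "\<not> ?thesis"
  then obtain h where h: "h ^ Q + h = rho + 1"
    using artin_schreier_dichotomy by blast
  have nz: "1 + \<alpha> + \<beta> \<noteq> 0"
    using kappa kappa_eq_0 by (auto simp: add_eq_0 add.commute)
  have root: "num Q rho AA z = cc * den Q rho z \<longleftrightarrow> z * (1 + \<alpha> + \<beta>) = 1" for z
  proof -
    have "num Q rho AA z = cc * den Q rho z \<longleftrightarrow> z + 1 + \<alpha> * z = \<beta> * z"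
      using R_root_iff[of "z + 1" z] R_num_den(1)[OF kappa, of z] kappa
        add_eq_0[of "num Q rho AA z" "cc * den Q rho z"] by simp
    also have "\<dots> \<longleftrightarrow> z * (1 + \<alpha> + \<beta>) + 1 = 0"
      using add_eq_0[of "z + 1 + \<alpha> * z" "\<beta> * z"] by (simp add: expand)
    finally show ?thesis
      by (simp only: add_eq_0)
  qed
  \<comment> \<open>The affine coordinate of the projective zero x = (alpha + beta) y of R.\<close>
  define z where "z = 1 / (1 + \<alpha> + \<beta>)"
  have z: "num Q rho AA z = cc * den Q rho z"
    using root[of z] nz by (simp add: z_def)
  have den: "den Q rho z \<noteq> 0"
  proof
    assume den0: "den Q rho z = 0"
    have "z + 1 + \<alpha> * z = \<beta> * z" "z + \<alpha> * (z + 1) = \<beta> * (z + 1)"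
      using R_root_iff[of "z + 1" z] R_root_iff[of z "z + 1"] R_num_den[OF kappa, of z] z den0
      by simp_all
    then have "(z + 1 + \<alpha> * z) + (z + \<alpha> * (z + 1)) = \<beta> * z + \<beta> * (z + 1)"
      by simp
    then have "\<beta> = \<alpha> + 1"
      by (simp add: expand)
    then show False
      using kappa kappa_eq_0 by blast
  qed
  \<comment> \<open>Otherwise w = z^Q + z satisfies w^2 + w = rho^2 + rho, so w is rho, outside the
    image by assumption, or rho + 1, which makes \<open>den\<close> vanish at z.\<close>
  have D: "z\<^sup>2 + z + AA \<noteq> 0"
  proof
    assume "z\<^sup>2 + z + AA = 0"
    then have "AA = z\<^sup>2 + z"
      by (simp add: add_eq_0)
    then have "(z ^ Q + z)\<^sup>2 + (z ^ Q + z) = rho\<^sup>2 + rho"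
      using cond by (simp add: power_Q_add expand power_mult_distrib)
    then have "z ^ Q + z = rho \<or> z ^ Q + z = rho + 1"
      using square_add_self_eq_iff[OF two] by blast
    then show False
      using none den add_eq_0[of "z ^ Q + z" "rho + 1"] by (auto simp: den_def add.assoc)
  qed
  \<comment> \<open>The solutions h and h + 1 differ, so one of them avoids z; this keeps
    \<open>r\<close> nonzero.\<close>
  obtain g where g: "g ^ Q + g = rho + 1" "g \<noteq> z"
  proof (cases "h = z")
    case True
    have "(h + 1) ^ Q + (h + 1) = rho + 1"
      using h by (simp add: power_Q_add ac_simps)
    then show ?thesis
      using True that[of "h + 1"] by simp
  qed (use h that in blast)
  \<comment> \<open>Solves r (z^2 + z + AA) + z = g, so that z + 1/r is a second point with value
    cc.\<close>
  define r where "r = (g + z) / (z\<^sup>2 + z + AA)"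
  have r: "r \<noteq> 0"
    using g(2) D by (simp add: r_def add_eq_0)
  have rg: "r * (z\<^sup>2 + z + AA) + z = g"
    using D by (simp add: r_def add.assoc)
  have "AA ^ Q + AA + rho\<^sup>2 + rho = 0" "g ^ Q + g + rho + 1 = 0"
    using cond g(1) by (simp_all add: add.assoc)
  then have "num Q rho AA (z + 1 / r) * den Q rho z + num Q rho AA z * den Q rho (z + 1 / r) = 0"
    using num_den_shift[OF r, of rho AA z] rg by simp
  then have "den Q rho z * (num Q rho AA (z + 1 / r)) = den Q rho z * (cc * den Q rho (z + 1 / r))"
    unfolding add_eq_0 using z by (simp add: mult_ac)
  then have "(z + 1 / r) * (1 + \<alpha> + \<beta>) = z * (1 + \<alpha> + \<beta>)"
    using den root[of "z + 1 / r"] root[of z] z by simp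
  then show False
    using nz r by simp
qed

text \<open>Since u = e (AA + 1) and v = e (AA + rho^2 + rho + 1), dividing the condition by e^Q
  leaves the identity for \<open>AA\<close>.\<close>

lemma coef_condition_iff:
  assumes "kappa \<noteq> 0"
  shows "u_coef Q \<alpha> \<beta> ^ Q = e_coef Q \<alpha> \<beta> ^ (Q - 1) * v_coef Q \<alpha> \<beta> \<longleftrightarrow>
    AA ^ Q + AA = rho\<^sup>2 + rho"
proof -
  define a b e where "a = \<alpha> ^ Q" and "b = \<beta> ^ (Q + 1)" and "e = kappa\<^sup>2"
  have e: "e_coef Q \<alpha> \<beta> = e"
  proof -
    have "x ^ (2 * Q + 2) = (x ^ (Q + 1))\<^sup>2" for x :: 'a
      by (simp only: power_mult[symmetric]) (simp add: mult.commute)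
    then show ?thesis
      by (simp add: e_coef_def e_def kappa_def power2_sum)
  qed
  have e0: "e \<noteq> 0"
    using assms by (simp add: e_def)
  have eA: "e * AA = \<alpha> + a * (\<alpha> * a + b)"
    using assms by (simp add: AA_def e_def a_def b_def)
  have e_rho: "e * rho\<^sup>2 = (\<alpha> + a)\<^sup>2" "e * rho = kappa * (\<alpha> + a)"
    using assms by (simp_all add: rho_def e_def a_def power2_eq_square)
  have kapab: "kappa = 1 + \<alpha> + a + \<alpha> * a + b"
    by (simp only: kappa_eq a_def b_def)
  have u: "u_coef Q \<alpha> \<beta> = e * (AA + 1)"
  proof -
    have "u_coef Q \<alpha> \<beta> = e + (\<alpha> + a * (\<alpha> * a + b))"
      unfolding e[symmetric]
      by (simp add: u_coef_def e_coef_def a_def b_def power_add mult_2_right algebra_simps)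
    then show ?thesis
      by (simp add: distrib_left eA add.commute)
  qed
  have v: "v_coef Q \<alpha> \<beta> = e * (AA + rho\<^sup>2 + rho + 1)"
  proof -
    have "v_coef Q \<alpha> \<beta> = e + (a + \<alpha> * (\<alpha> * a + b))"
      unfolding e[symmetric]
      by (simp add: v_coef_def e_coef_def a_def b_def power_add power2_eq_square mult_2_right algebra_simps)
    also have "a + \<alpha> * (\<alpha> * a + b) = e * AA + e * rho\<^sup>2 + e * rho"
      unfolding eA e_rho kapab by (simp add: expand)
    finally show ?thesis
      by (simp add: distrib_left ac_simps)
  qed
  have eQ: "e ^ (Q - 1) * e = e ^ Q"
    by (rule power_minus_mult[OF Q_pos])
  have "u_coef Q \<alpha> \<beta> ^ Q = e_coef Q \<alpha> \<beta> ^ (Q - 1) * v_coef Q \<alpha> \<beta> \<longleftrightarrow>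
      e ^ Q * (AA + 1) ^ Q = e ^ Q * (AA + rho\<^sup>2 + rho + 1)"
    unfolding u v e eQ[symmetric] power_mult_distrib by (simp only: mult.assoc)
  also have "\<dots> \<longleftrightarrow> AA ^ Q = AA + rho\<^sup>2 + rho"
    using e0 by (simp add: power_Q_add)
  also have "\<dots> \<longleftrightarrow> AA ^ Q + AA = rho\<^sup>2 + rho"
    using add_eq_0[of "AA ^ Q" "AA + rho\<^sup>2 + rho"] add_eq_0[of "AA ^ Q + AA" "rho\<^sup>2 + rho"]
    by (simp add: add.assoc)
  finally show ?thesis .
qed

end

subsection \<open>Sums over roots of unity\<close>

lemma finite_card_roots_of_unity_le:
  assumes "n > 0"
  shows "finite {x::'a::field. x ^ n = 1}" and "card {x::'a. x ^ n = 1} \<le> n"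
proof -
  have nz: "monom (1::'a) n - 1 \<noteq> 0"
    using assms by (metis degree_1 degree_monom_eq eq_iff_diff_eq_0 less_irrefl zero_neq_one)
  have eq: "{x::'a. x ^ n = 1} = {x. poly (monom 1 n - 1) x = 0}"
    by (auto simp: poly_monom)
  show "finite {x::'a. x ^ n = 1}"
    unfolding eq by (rule poly_roots_finite[OF nz])
  have "card {x::'a. x ^ n = 1} \<le> degree (monom (1::'a) n - 1)"
    unfolding eq by (rule card_poly_roots_bound[OF nz])
  also have "\<dots> \<le> n"
    by (rule degree_diff_le) (simp_all add: degree_monom_le)
  finally show "card {x::'a. x ^ n = 1} \<le> n" .
qed

text \<open>Multiplication by a root c permutes the roots and scales the sum by c^j. Some c has c^j
  different from 1, since x^i = 1 with i = j mod n has fewer than n solutions.\<close>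

lemma sum_powers_roots_of_unity:
  fixes j n :: nat
  assumes n: "n > 0" and card: "card {x::'a::field. x ^ n = 1} = n"
  shows "(\<Sum>x\<in>{x::'a. x ^ n = 1}. x ^ j) = (if n dvd j then of_nat n else 0)"
proof (cases "n dvd j")
  case True
  then have "x ^ j = 1" if "x ^ n = 1" for x :: 'a
    using that by (auto simp: power_mult)
  then show ?thesis
    using True card by simp
next
  case False
  define i where "i = j mod n"
  have i: "0 < i" "i < n"
    using False n by (auto simp: i_def dvd_eq_mod_eq_0)
  let ?U = "{x::'a. x ^ n = 1}"
  have "\<exists>c\<in>?U. c ^ i \<noteq> 1"
  proof (rule ccontr)
    assume "\<not> ?thesis"
    then have "n \<le> card {x::'a. x ^ i = 1}"
      using card card_mono[of "{x::'a. x ^ i = 1}" ?U] finite_card_roots_of_unity_le(1)[OF i(1)] by auto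
    also have "\<dots> \<le> i"
      by (rule finite_card_roots_of_unity_le(2)[OF i(1)])
    finally show False
      using i by simp
  qed
  then obtain c :: 'a where c: "c ^ n = 1" "c ^ i \<noteq> 1"
    by blast
  have c0: "c \<noteq> 0"
    using c n by (auto simp: power_0_left)
  have "c ^ j = c ^ i"
  proof -
    have "c ^ j = c ^ (n * (j div n) + i)"
      by (simp add: i_def)
    then show ?thesis
      using c by (simp add: power_add power_mult)
  qed
  have bij: "bij_betw ((*) c) ?U ?U"
    by (rule bij_betwI[where g = "\<lambda>y. y / c"])
      (use c c0 in \<open>auto simp: power_mult_distrib power_divide\<close>)
  have "(\<Sum>x\<in>?U. x ^ j) = (\<Sum>x\<in>?U. (c * x) ^ j)"
    using sum.reindex_bij_betw[OF bij, of "\<lambda>x. x ^ j"] by simp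
  also have "\<dots> = c ^ i * (\<Sum>x\<in>?U. x ^ j)"
    by (simp add: power_mult_distrib sum_distrib_left \<open>c ^ j = c ^ i\<close>)
  finally show ?thesis
    using c False by simp
qed

text \<open>The images of the q field elements already exhaust the at most q roots of x^q =
  x.\<close>

lemma range_to_ac_eq_fixed:
  "range (to_ac :: 'a::{field,finite} \<Rightarrow> _) = {x. x ^ CARD('a) = x}"
proof (rule card_subset_eq)
  let ?p = "monom (1::'a alg_closure) CARD('a) - monom 1 1"
  have gt: "CARD('a) > 1"
    using card_mono[of "UNIV::'a set" "{0, 1}"] by simp
  have nz: "?p \<noteq> 0"
    using gt by (metis degree_monom_eq eq_iff_diff_eq_0 less_irrefl zero_neq_one)
  have eq: "{x::'a alg_closure. x ^ CARD('a) = x} = {x. poly ?p x = 0}"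
    by (auto simp: poly_monom)
  show fin: "finite {x::'a alg_closure. x ^ CARD('a) = x}"
    unfolding eq by (rule poly_roots_finite[OF nz])
  show sub: "range (to_ac :: 'a \<Rightarrow> _) \<subseteq> {x. x ^ CARD('a) = x}"
    by (auto simp: to_ac_power[symmetric] finite_field_power_card simp del: to_ac_power)
  have "card {x::'a alg_closure. x ^ CARD('a) = x} \<le> degree ?p"
    unfolding eq by (rule card_poly_roots_bound[OF nz])
  also have "\<dots> \<le> CARD('a)"
    using gt by (intro degree_diff_le) (auto intro: order.trans[OF degree_monom_le])
  finally show "card (range (to_ac :: 'a \<Rightarrow> _)) = card {x::'a alg_closure. x ^ CARD('a) = x}"
    using card_mono[OF fin sub] by (simp add: card_image inj_to_ac)
qed

text \<open>Modulo 2^k + 1 the number 2^m 2^(k-m) is -1, so the right side is 2^m (i + 1 - 2^(k-m));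
  2^m is invertible and the other factor is smaller than the modulus. This finds the surviving term
  of a power sum.\<close>

lemma unique_dvd_two_power:
  fixes k m i :: nat
  assumes "m < k" and "i < 2 ^ k"
  shows "(2 ^ k + 1) dvd (1 + 2 ^ m * (i + 1)) \<longleftrightarrow> i = (2 ^ (k - m) - 1 :: nat)"
proof -
  define n j :: int where "n = 2 ^ k + 1" and "j = 2 ^ (k - m)"
  have j: "2 ^ m * j = n - 1" "0 < j" "j < n"
    using assms by (auto simp: n_def j_def power_add[symmetric] power_increasing
        intro: le_less_trans[of _ "2 ^ k"])
  have cop: "coprime n (2 ^ m)"
    using assms by (simp add: n_def)
  have "int (2 ^ k + 1) dvd int (1 + 2 ^ m * (i + 1)) \<longleftrightarrow> n dvd 1 + 2 ^ m * (int i + 1)"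
    by (simp only: n_def of_nat_add of_nat_mult of_nat_power of_nat_numeral of_nat_1)
  also have "1 + 2 ^ m * (int i + 1) = 2 ^ m * (int i + 1 - j) + n"
    using j(1) by (simp add: algebra_simps)
  also have "n dvd \<dots> \<longleftrightarrow> n dvd int i + 1 - j"
    using cop by (simp add: coprime_dvd_mult_right_iff)
  also have "\<dots> \<longleftrightarrow> int i + 1 - j = 0"
  proof -
    have "int i < 2 ^ k"
      using assms(2) by (metis of_nat_less_iff of_nat_numeral of_nat_power)
    then have "\<bar>int i + 1 - j\<bar> < \<bar>n\<bar>"
      using j(2,3) unfolding n_def by linarith
    then show ?thesis
      using dvd_imp_le_int[of "int i + 1 - j" n] by (auto simp del: abs_of_nonneg)
  qed
  also have "\<dots> \<longleftrightarrow> i = 2 ^ (k - m) - 1"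
  proof -
    have "j = int (2 ^ (k - m))"
      by (simp add: j_def)
    then show ?thesis
      using j(2) by linarith
  qed
  finally show ?thesis
    by (simp only: int_dvd_int_iff)
qed

text \<open>Expands (x + r) / (r x + 1) as a polynomial in x: the geometric sum telescopes to x -
  r^q x^(q + 1).\<close>

lemma mobius_expansion:
  fixes r x :: "'a::comm_ring_1"
  assumes two: "(2::'a) = 0" and "r ^ q = r" and "x ^ (q + 1) = 1"
  shows "(r * x + 1) * (\<Sum>i<q. r ^ i * x ^ (i + 1)) = x + r"
proof -
  have neg: "-y = y" for y :: 'a
    using add_self_char2[OF two, of y] by (simp add: neg_eq_iff_add_eq_0)
  have "(r * x + 1) * (\<Sum>i<q. r ^ i * x ^ (i + 1)) = x * ((1 - r * x) * (\<Sum>i<q. (r * x) ^ i))"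
    by (simp add: sum_distrib_left power_mult_distrib neg diff_conv_add_uminus mult_ac add_ac
        del: add_uminus_conv_diff)
  also have "\<dots> = x * (1 - (r * x) ^ q)"
    by (simp only: one_diff_power_eq)
  also have "\<dots> = x - r * x ^ (q + 1)"
    using assms(2) by (simp add: power_mult_distrib algebra_simps)
  finally show ?thesis
    using assms(3) neg by (metis diff_conv_add_uminus mult_1_right)
qed

subsection \<open>Permutations satisfy the coefficient identity\<close>

context gold_field
begin

lemma split_case:
  fixes \<rho> A \<zeta> :: 'a
  assumes zeta: "\<zeta>\<^sup>2 + \<zeta> = A" and den: "\<And>z. den Q \<rho> z \<noteq> 0"
    and inj: "inj (\<lambda>z. num Q \<rho> A z / den Q \<rho> z)"
  shows "A ^ Q + A = \<rho>\<^sup>2 + \<rho>"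
proof -
  have factor: "num Q \<rho> A z + \<zeta> * den Q \<rho> z = (z ^ Q + \<zeta> + \<rho>) * (z + \<zeta>)" for z
    unfolding zeta[symmetric] num_def den_def by (simp add: expand)
  have root: "num Q \<rho> A z / den Q \<rho> z = \<zeta>" if "(z ^ Q + \<zeta> + \<rho>) * (z + \<zeta>) = 0" for z
    using factor[of z] that den[of z] add_eq_0[of "num Q \<rho> A z" "\<zeta> * den Q \<rho> z"]
    by (simp add: field_simps)
  obtain y where y: "y ^ Q = \<zeta> + \<rho>"
    using power_Q_surj by blast
  have "y = \<zeta>"
    using injD[OF inj, of y \<zeta>] root[of y] root[of \<zeta>] y by (simp add: add.assoc)
  \<comment> \<open>Now zeta^Q = zeta + rho, and A^Q is obtained by applying x^2 + x to it.\<close>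
  then have "A ^ Q = (\<zeta> + \<rho>)\<^sup>2 + (\<zeta> + \<rho>)"
    using y unfolding zeta[symmetric] by (simp add: power_Q_add power2_eq_square power_mult_distrib)
  then show ?thesis
    unfolding zeta[symmetric] by (simp add: expand)
qed

lemma nonsplit_case:
  fixes \<rho> A :: 'a
  assumes nonsplit: "\<nexists>\<zeta>. \<zeta>\<^sup>2 + \<zeta> = A" and den: "\<And>z. den Q \<rho> z \<noteq> 0"
    and inj: "inj (\<lambda>z. num Q \<rho> A z / den Q \<rho> z)"
  shows "A ^ Q + A = \<rho>\<^sup>2 + \<rho>"
proof -
  \<comment> \<open>On F_q the exponent of 2 counts only modulo k; reducing it below k makes
    \<open>unique_dvd_two_power\<close> applicable.\<close>
  define q m P where "q = (2 ^ k :: nat)" and "m = l mod k" and "P = (2 ^ m :: nat)"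
  have "m < k"
    using k by (simp add: m_def)
  have two': "(2 :: 'a alg_closure) = 0"
    using two by (metis to_ac_numeral to_ac_0)
  note cancel = char2_cancel[OF two']
  note add_eq_0' = add_eq_zero_char2[OF two']
  have addq: "(x + y) ^ q = x ^ q + y ^ q" and addP: "(x + y) ^ P = x ^ P + y ^ P"
    for x y :: "'a alg_closure"
    unfolding q_def P_def by (rule add_power_two_power[OF two'])+
  have range_eq: "x \<in> range to_ac \<longleftrightarrow> x ^ q = x" for x :: "'a alg_closure"
    using range_to_ac_eq_fixed[where 'a = 'a] card by (auto simp: q_def)
  have QP: "x ^ Q = x ^ P" for x :: 'a
  proof -
    have "x ^ Q = x ^ (q ^ (l div k) * P)"
      unfolding Q q_def P_def m_def
      by (simp only: power_mult[symmetric] power_add[symmetric] mult_div_mod_eq)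
    then show ?thesis
      using iterate_power_fixed[OF finite_field_power_card[of x], of "l div k"] card
      by (simp add: power_mult q_def)
  qed
  obtain z0 where "poly [:to_ac A, 1, 1:] z0 = 0"
    using alg_closed_imp_poly_has_root[of "[:to_ac A, 1, 1:]"] by auto
  then have "to_ac A + (z0\<^sup>2 + z0) = 0"
    by (simp add: power2_eq_square algebra_simps)
  then have z0: "z0\<^sup>2 + z0 = to_ac A"
    by (simp add: add_eq_0')
  have z0_notin: "z0 \<notin> range to_ac"
  proof
    assume "z0 \<in> range to_ac"
    then obtain \<zeta> where "z0 = to_ac \<zeta>"
      by auto
    then have "to_ac (\<zeta>\<^sup>2 + \<zeta>) = to_ac A"
      using z0 by simp
    then show False
      using nonsplit by (simp only: to_ac_eq_iff) blast
  qed
  \<comment> \<open>Both z0 and its q-th power are roots of x^2 + x = A, and they differ because z0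
    is outside F_q.\<close>
  have "(z0 ^ q)\<^sup>2 + z0 ^ q = (z0\<^sup>2 + z0) ^ q"
    by (simp add: addq power_mult[symmetric] mult.commute)
  also have "\<dots> = z0\<^sup>2 + z0"
    using range_eq[of "to_ac A"] unfolding z0 by simp
  finally have z0q: "z0 ^ q = z0 + 1"
    using z0_notin range_eq square_add_self_eq_iff[OF two'] by blast
  \<comment> \<open>The shift that writes the factor z^P + z0 + rho of f + z0 as (z + z0)^P +
    s.\<close>
  define s where "s = z0 ^ P + z0 + to_ac \<rho>"
  have "s ^ q = s"
  proof -
    have "(z0 ^ P) ^ q = (z0 ^ q) ^ P"
      by (simp add: power_mult[symmetric] mult.commute)
    moreover have "to_ac \<rho> ^ q = to_ac \<rho>"
      using range_eq[of "to_ac \<rho>"] by simp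
    ultimately show ?thesis
      unfolding s_def addq z0q addP by (simp add: cancel add_ac)
  qed
  \<comment> \<open>The denominator is the q-th power of the numerator, so T z is a (q + 1)-st root
    of unity; the omitted value 1 belongs to infinity.\<close>
  define T where "T = (\<lambda>z. (to_ac z + z0) / (to_ac z + z0 + 1))"
  define f where "f = (\<lambda>z. num Q \<rho> A z / den Q \<rho> z)"
  have nz: "to_ac z + z0 \<noteq> 0" "to_ac z + z0 + 1 \<noteq> 0" for z
  proof -
    show "to_ac z + z0 \<noteq> 0"
      using z0_notin by (auto simp: add_eq_0')
    have "to_ac z + z0 + 1 = to_ac (z + 1) + z0"
      by (simp add: add_ac)
    also have "\<dots> \<noteq> 0"
      using z0_notin by (auto simp: add_eq_0' simp del: to_ac_add)
    finally show "to_ac z + z0 + 1 \<noteq> 0" .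
  qed
  have T_ne1: "T z \<noteq> 1" for z
    using nz[of z] by (simp add: T_def)
  have T_inj: "inj T"
  proof (rule injI)
    fix z w assume "T z = T w"
    then have "(to_ac z + z0) * (to_ac w + z0 + 1) = (to_ac w + z0) * (to_ac z + z0 + 1)"
      using nz by (simp add: T_def frac_eq_eq)
    then show "z = w"
      by (simp add: algebra_simps)
  qed
  have T_root: "T z ^ (q + 1) = 1" for z
  proof -
    have "to_ac z ^ q = to_ac z"
      using range_eq[of "to_ac z"] by simp
    then have "T z ^ q = (to_ac z + z0 + 1) / (to_ac z + z0)"
      by (simp add: T_def power_divide addq z0q add_ac cancel)
    then show ?thesis
      using nz[of z] by (simp add: T_def)
  qed
  define M where "M = {x::'a alg_closure. x ^ (q + 1) = 1}"
  have M_eq: "insert 1 (range T) = M"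
  proof (rule card_seteq)
    show "finite M" "insert 1 (range T) \<subseteq> M"
      using T_root finite_card_roots_of_unity_le(1)[of "q + 1"] by (auto simp: M_def)
    have "card (insert 1 (range T)) = q + 1"
      using T_ne1 T_inj card by (subst card_insert_disjoint) (auto simp: card_image q_def)
    then show "card M \<le> card (insert 1 (range T))"
      using finite_card_roots_of_unity_le(2)[of "q + 1"] by (simp add: M_def)
  qed
  have sum_M: "(\<Sum>x\<in>M. h x) = h 1 + (\<Sum>z\<in>UNIV. h (T z))" for h :: "_ \<Rightarrow> 'a alg_closure"
    unfolding M_eq[symmetric] using T_ne1 T_inj
    by (subst sum.insert) (auto simp: sum.reindex)
  have "card M = q + 1"
    unfolding M_eq[symmetric] using T_ne1 T_inj card
    by (subst card_insert_disjoint) (auto simp: card_image q_def)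
  have "of_nat (q + 1) = (1 :: 'a alg_closure)"
    using two' k by (simp add: q_def)
  then have powsum: "(\<Sum>x\<in>M. x ^ j) = (if (q + 1) dvd j then 1 else 0)" for j
    using sum_powers_roots_of_unity[of "q + 1", where 'a = "'a alg_closure"] \<open>card M = q + 1\<close>
    unfolding M_def by (metis add_gr_0 zero_less_one)
  \<comment> \<open>With X = (T z)^P one has (z + z0)^P = X / (X + 1); writing (f + z0) / (f + z0 +
    1) in terms of T z and X gives this formula.\<close>
  define \<phi> where "\<phi> = (\<lambda>x. x * ((s + 1) * x ^ P + s) / (s * x ^ P + (s + 1)))"
  have phi_T: "\<phi> (T z) = T (f z)" for z
  proof -
    define W zP where "W = (to_ac z + z0) ^ P" and "zP = to_ac z ^ P"
    have "(to_ac z + z0 + 1) ^ P \<noteq> 0"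
      using nz(2)[of z] by simp
    then have W1: "W + 1 \<noteq> 0"
      unfolding addP[of _ 1] W_def by simp
    have TP: "T z ^ P = W / (W + 1)"
      by (simp add: T_def W_def power_divide addP)
    have Ws: "W + s = zP + z0 + to_ac \<rho>"
      by (simp add: W_def s_def addP zP_def cancel add_ac)
    have up: "(s + 1) * T z ^ P + s = (W + s) / (W + 1)"
      using W1 unfolding TP by (simp add: field_simps cancel)
    have down: "s * T z ^ P + (s + 1) = (W + s + 1) / (W + 1)"
      using W1 unfolding TP by (simp add: field_simps cancel)
    have V: "\<phi> (T z) = T z * (zP + z0 + to_ac \<rho>) / (zP + z0 + to_ac \<rho> + 1)"
      unfolding \<phi>_def up down Ws using W1 by simp
    have dz: "to_ac (den Q \<rho> z) \<noteq> 0"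
      using den by simp
    have n: "to_ac (num Q \<rho> A z) + z0 * to_ac (den Q \<rho> z) = (zP + z0 + to_ac \<rho>) * (to_ac z + z0)"
      by (simp add: num_def den_def QP zP_def z0[symmetric] expand cancel)
    have n1: "to_ac (num Q \<rho> A z) + z0 * to_ac (den Q \<rho> z) + to_ac (den Q \<rho> z)
        = (zP + z0 + to_ac \<rho> + 1) * (to_ac z + z0 + 1)"
      by (simp add: num_def den_def QP zP_def z0[symmetric] expand cancel)
    have divide_cancel: "(a / d) / (b / d) = a / b" if "d \<noteq> 0" for a b d :: "'a alg_closure"
      using that by simp
    have Tn: "to_ac (f z) + z0 = (to_ac (num Q \<rho> A z) + z0 * to_ac (den Q \<rho> z)) / to_ac (den Q \<rho> z)"
      using dz by (simp add: f_def add_divide_distrib)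
    have Td: "to_ac (f z) + z0 + 1 =
        (to_ac (num Q \<rho> A z) + z0 * to_ac (den Q \<rho> z) + to_ac (den Q \<rho> z)) / to_ac (den Q \<rho> z)"
      using dz by (simp add: f_def add_divide_distrib)
    have Tf: "T (f z) = (to_ac (num Q \<rho> A z) + z0 * to_ac (den Q \<rho> z))
        / (to_ac (num Q \<rho> A z) + z0 * to_ac (den Q \<rho> z) + to_ac (den Q \<rho> z))"
      unfolding T_def Td unfolding Tn by (rule divide_cancel[OF dz])
    have "\<phi> (T z) = (zP + z0 + to_ac \<rho>) * (to_ac z + z0)
        / ((zP + z0 + to_ac \<rho> + 1) * (to_ac z + z0 + 1))"
      unfolding V by (simp add: T_def mult.commute)
    also have "\<dots> = T (f z)"
      unfolding Tf n1 unfolding n by (rule refl)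
    finally show ?thesis .
  qed
  \<comment> \<open>Reindexing by f, with 1 fixed by \<open>\<phi>\<close>, identifies the sum of
    \<open>\<phi>\<close> with the sum of all roots, which is 0.\<close>
  have "bij f"
    using inj by (simp add: f_def bij_def finite_UNIV_inj_surj)
  have "\<phi> 1 = 1"
    by (simp add: \<phi>_def add_ac cancel)
  then have "(\<Sum>x\<in>M. \<phi> x) = 1 + (\<Sum>z\<in>UNIV. T (f z))"
    by (simp add: sum_M phi_T)
  also have "(\<Sum>z\<in>UNIV. T (f z)) = (\<Sum>z\<in>UNIV. T z)"
    by (rule sum.reindex_bij_betw[OF \<open>bij f\<close>])
  also have "1 + \<dots> = (\<Sum>x\<in>M. x)"
    by (simp add: sum_M)
  also have "\<dots> = 0"
    using powsum[of 1] k by (simp add: q_def)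
  finally have sum0: "(\<Sum>x\<in>M. \<phi> x) = 0" .
  have "s = 0 \<or> s + 1 = 0"
  proof (rule ccontr)
    assume s: "\<not> ?thesis"
    define r where "r = s / (s + 1)"
    have "r ^ q = r"
      using \<open>s ^ q = s\<close> by (simp add: r_def power_divide addq)
    have expand_phi: "\<phi> x = (\<Sum>i<q. r ^ i * x ^ (1 + P * (i + 1)))" if "x \<in> M" for x
    proof -
      have "(x ^ P) ^ (q + 1) = (x ^ (q + 1)) ^ P"
        by (simp only: power_mult[symmetric] mult.commute)
      then have xP: "(x ^ P) ^ (q + 1) = 1"
        using that by (simp add: M_def)
      \<comment> \<open>Taking (q + 1)-st powers of \<open>r * x ^ P = 1\<close> gives r^2 = 1,
        hence r = 1, while s / (s + 1) is never 1.\<close>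
      have "r * x ^ P + 1 \<noteq> 0"
      proof
        assume "r * x ^ P + 1 = 0"
        then have rx: "r * x ^ P = 1"
          by (simp add: add_eq_0')
        have "(r * x ^ P) ^ (q + 1) = r * r"
          using \<open>r ^ q = r\<close> xP unfolding power_mult_distrib by (simp add: power_add)
        then have "(r + 1)\<^sup>2 = 0"
          using rx by (simp add: expand cancel)
        then have "r = 1"
          by (simp add: add_eq_0')
        then show False
          using s by (simp add: r_def)
      qed
      then have "(x ^ P + r) / (r * x ^ P + 1) = (\<Sum>i<q. r ^ i * (x ^ P) ^ (i + 1))"
        using mobius_expansion[OF two' \<open>r ^ q = r\<close> xP] by (simp add: nonzero_divide_eq_eq mult.commute)
      moreover have "\<phi> x = x * ((x ^ P + r) / (r * x ^ P + 1))"
      proof -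
        have "(s + 1) * x ^ P + s = (s + 1) * (x ^ P + r)"
          "s * x ^ P + (s + 1) = (s + 1) * (r * x ^ P + 1)"
          using s by (simp_all add: r_def distrib_left)
        then show ?thesis
          unfolding \<phi>_def using s by simp
      qed
      ultimately have "\<phi> x = x * (\<Sum>i<q. r ^ i * (x ^ P) ^ (i + 1))"
        by simp
      also have "\<dots> = (\<Sum>i<q. r ^ i * x ^ (1 + P * (i + 1)))"
        by (simp only: sum_distrib_left power_add power_mult power_one_right mult_ac)
      finally show ?thesis .
    qed
    have "(\<Sum>x\<in>M. \<phi> x) = (\<Sum>x\<in>M. \<Sum>i<q. r ^ i * x ^ (1 + P * (i + 1)))"
      by (intro sum.cong refl expand_phi)
    also have "\<dots> = (\<Sum>i<q. r ^ i * (\<Sum>x\<in>M. x ^ (1 + P * (i + 1))))"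
      by (subst sum.swap) (simp only: sum_distrib_left)
    \<comment> \<open>Exactly one exponent is divisible by q + 1, so a single power of r
      survives.\<close>
    also have "\<dots> = (\<Sum>i<q. if i = 2 ^ (k - m) - 1 then r ^ i else 0)"
    proof (rule sum.cong)
      fix i assume "i \<in> {..<q}"
      then have "(q + 1) dvd (1 + P * (i + 1)) \<longleftrightarrow> i = 2 ^ (k - m) - 1"
        unfolding q_def P_def using unique_dvd_two_power[OF \<open>m < k\<close>] by blast
      then show "r ^ i * (\<Sum>x\<in>M. x ^ (1 + P * (i + 1))) = (if i = 2 ^ (k - m) - 1 then r ^ i else 0)"
        unfolding powsum by simp
    qed simp
    also have "\<dots> = r ^ (2 ^ (k - m) - 1)"
    proof -
      have "(2::nat) ^ (k - m) \<le> 2 ^ k" "(0::nat) < 2 ^ (k - m)"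
        by (auto intro: power_increasing)
      then have "2 ^ (k - m) - 1 < q"
        unfolding q_def by linarith
      then show ?thesis
        by simp
    qed
    finally have "r = 0"
      using sum0 by simp
    then show False
      using s by (simp add: r_def)
  qed
  then have "s\<^sup>2 + s = 0"
    by (auto simp: power2_eq_square add_eq_0')
  \<comment> \<open>Squaring is additive and commutes with the P-th power, so z0 enters only through
    z0^2 + z0 = A.\<close>
  moreover have "s\<^sup>2 + s = (z0\<^sup>2 + z0) ^ P + (z0\<^sup>2 + z0) + ((to_ac \<rho>)\<^sup>2 + to_ac \<rho>)"
    unfolding s_def by (simp add: addP power2_eq_square power_mult_distrib distrib_left distrib_right
        mult_ac add_ac cancel)
  ultimately have "to_ac (A ^ P + A + (\<rho>\<^sup>2 + \<rho>)) = 0"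
    unfolding z0 by simp
  then have "A ^ P + A + (\<rho>\<^sup>2 + \<rho>) = 0"
    by (simp only: to_ac_eq_0_iff)
  then show ?thesis
    by (simp only: QP add_eq_0)
qed

end

theorem corollary9p6:
  fixes k l q Q :: nat
    and \<alpha> \<beta> :: "'a::{field,finite}"
  assumes "k > 0" and "l > 0" and "coprime k l" and "odd k"
    and "q = 2 ^ k" and "Q = 2 ^ l"
    and "CARD('a) = q"
    and "\<alpha> \<noteq> 0" and "\<beta> \<noteq> 0"
  shows "bij (psi Q \<alpha> \<beta>) \<longleftrightarrow>
    \<beta> \<noteq> \<alpha> + 1 \<and> u_coef Q \<alpha> \<beta> ^ Q = e_coef Q \<alpha> \<beta> ^ (Q - 1) * v_coef Q \<alpha> \<beta>"
proof -
  interpret gold_pair k l Q "TYPE('a)" \<alpha> \<beta>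
    using assms by unfold_locales auto
  have bij: "bij (psi Q \<alpha> \<beta>) \<longleftrightarrow> inj (psi Q \<alpha> \<beta>)"
    by (auto simp: bij_def finite_UNIV_inj_surj)
  show ?thesis
  proof (cases "kappa = 0")
    case True
    then have beta: "\<beta> = \<alpha> + 1"
      using kappa_eq_0 by blast
    have "psi Q \<alpha> \<beta> (1, 1) = psi Q \<alpha> \<beta> (0, 0)"
      using R_root_iff[of 1 1] R_root_iff[of 0 0] by (simp add: psi_def beta add.commute)
    then have "\<not> inj (psi Q \<alpha> \<beta>)"
      by (metis injD prod.inject zero_neq_one)
    then show ?thesis
      using bij beta by blast
  next
    case False
    have "inj (psi Q \<alpha> \<beta>) \<longleftrightarrow> AA ^ Q + AA = rho\<^sup>2 + rho"
    proof
      assume "inj (psi Q \<alpha> \<beta>)"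
      then have "\<forall>y s y' s'. form1 Q rho AA y s = form1 Q rho AA y' s' \<longrightarrow>
          form2 Q rho y s = form2 Q rho y' s' \<longrightarrow> y = y' \<and> s = s'"
        using inj_psi_iff[OF False] by blast
      note fraction_inj[OF this]
      then show "AA ^ Q + AA = rho\<^sup>2 + rho"
        using split_case nonsplit_case by blast
    next
      assume "AA ^ Q + AA = rho\<^sup>2 + rho"
      then show "inj (psi Q \<alpha> \<beta>)"
        using inj_psi_iff[OF False] forms_inj rho_in_range[OF False] by blast
    qed
    then show ?thesis
      using bij coef_condition_iff[OF False] kappa_eq_0 False by blast
  qed
qed

end
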